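(* Let $(E,\mathcal{B})$ be a measurable space with a $\sigma$-finite measure $\mu$ on it. A subset $\mathcal{F}\subset L^1(\mu)$ is uniformly integrable, i.e. $$\lim_{C\to\infty}\sup_{f\in\mathcal{F}}\int_{\{|f|>C\}}|f|\,d\mu=0,$$ if and only if there exists a function $G:[0,+\infty)\to\mathbb{R}$ such that: (1) $G(x)=0$ for $0\le x\le1$; (2) $G$ is non-decreasing and convex, and smooth on $(0,+\infty)$; (3) $\sup_{f\in\mathcal{F}}\int_EG(|f|)\,d\mu\le1$; (4) the function $H(x):=G(e^x)e^{-x}$ on $\mathbb{R}$ satisfies $\lim_{x\to+\infty}H(x)=+\infty$, and its derivative $H'$ is smooth with $0\le H'(x)\le1$ for all $x\in\mathbb{R}$.
   Context: Smooth means $C^\infty$. The measure $\mu$ is allowed to be infinite; uniform integrability means exactly the displayed condition. *)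

theory Defs
  imports "HOL-Analysis.Analysis"
begin

(* The integrals and the supremum live in [0, \<infinity>], so an infinite supremum is a genuine
   value; in particular it may be infinite for small C. Over the empty family it is 0. *)
definition uniformly_integrable :: "'a measure \<Rightarrow> ('a \<Rightarrow> real) set \<Rightarrow> bool" where
  "uniformly_integrable M F \<longleftrightarrow>
     ((\<lambda>C::real. SUP f\<in>F. \<integral>\<^sup>+x\<in>{y \<in> space M. \<bar>f y\<bar> > C}. ennreal \<bar>f x\<bar> \<partial>M) \<longlongrightarrow> 0) at_top"

(* C-infinity on S. Intended for open S: deriv f x looks at a full neighbourhood of x, so on an
   open set the condition depends only on the values of f on S. *)
definition smooth_on :: "real set \<Rightarrow> (real \<Rightarrow> real) \<Rightarrow> bool" where
  "smooth_on S f \<longleftrightarrow> (\<forall>n. \<forall>x\<in>S. (deriv ^^ n) f differentiable (at x))"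

end

theory Submission
  imports Defs "HOL-Computational_Algebra.Polynomial"
begin

text \<open>
  Take P smooth, convex, zero on (-\<infinity>, 1], with P t \<le> t and P t / t bounded below for large t, and
  put G t = (1/4) \<Sum>n. a n * P (t / a n). The n-th term is at most t and vanishes for t \<le> a n, so
  the integral of G(|f|) is at most the sum of the tails of |f| beyond the a n, which uniform
  integrability makes at most 1 if the a n grow fast enough; each term contributes a fixed positive
  amount to the limit of G t / t, so G is superlinear. With t = exp x, the derivative of H is the
  sum of the (t P'(t / a n) - a n * P (t / a n)) / (4 t); for P t = (t - 1) exp (- 1 / (t - 1)) the
  n-th term lies between 0 and a n / (2 t), and vanishes for t \<le> a n, so a (n + 1) \<ge> 2 a n
  bounds the sum by 1. Conversely, superlinearity gives |f| \<le> r * G(|f|) wherever |f| is large.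
\<close>

section \<open>Smooth functions of one real variable\<close>

text \<open>Counting the order gives a predicate on which induction runs. With \<open>k < n\<close>
  it says that \<open>f\<close> is \<open>n\<close> times differentiable at each point of
  \<open>S\<close>, so order 0 imposes nothing.\<close>

definition diff_times_on :: "nat \<Rightarrow> real set \<Rightarrow> (real \<Rightarrow> real) \<Rightarrow> bool" where
  "diff_times_on n S f \<longleftrightarrow> (\<forall>k<n. \<forall>x\<in>S. (deriv ^^ k) f differentiable (at x))"

lemma smooth_on_iff_diff_times_on: "smooth_on S f \<longleftrightarrow> (\<forall>n. diff_times_on n S f)"
  unfolding smooth_on_def diff_times_on_def by (meson lessI)

lemma diff_times_on_0 [simp]: "diff_times_on 0 S f"
  by (simp add: diff_times_on_def)

lemma diff_times_on_Suc:
  "diff_times_on (Suc n) S f \<longleftrightarrow>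
    (\<forall>x\<in>S. f differentiable (at x)) \<and> diff_times_on n S (deriv f)"
  unfolding diff_times_on_def by (auto simp: All_less_Suc2 funpow_Suc_right simp del: funpow.simps)

lemma diff_times_on_SucD: "diff_times_on (Suc n) S f \<Longrightarrow> diff_times_on n S f"
  unfolding diff_times_on_def by auto

text \<open>Since \<open>S\<close> is open, agreement on \<open>S\<close> is agreement near each
  point of \<open>S\<close>, so the derivatives agree on \<open>S\<close> as well and the induction
  continues with them.\<close>

lemma diff_times_on_cong:
  assumes "open S" "\<And>x. x \<in> S \<Longrightarrow> f x = g x" "diff_times_on n S f"
  shows "diff_times_on n S g"
  using assms
proof (induction n arbitrary: f g)
  case (Suc n)
  have ev: "\<forall>\<^sub>F y in nhds x. f y = g y" if "x \<in> S" for x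
    using Suc.prems(1,2) that by (auto simp: eventually_nhds)
  have "g differentiable (at x)" if "x \<in> S" for x
  proof -
    have "f differentiable (at x)"
      using Suc.prems(3) that by (simp add: diff_times_on_Suc)
    then obtain D where "(f has_real_derivative D) (at x)"
      by (auto simp: real_differentiable_def)
    then have "(g has_real_derivative D) (at x)"
      by (simp add: DERIV_cong_ev[OF refl ev[OF that] refl, symmetric])
    then show ?thesis
      by (auto simp: real_differentiable_def)
  qed
  moreover have "deriv f x = deriv g x" if "x \<in> S" for x
    by (intro deriv_cong_ev ev that refl)
  ultimately show ?case
    using Suc.IH[of "deriv f" "deriv g"] Suc.prems by (simp add: diff_times_on_Suc)
qed simp

text \<open>Lets an explicit formula \<open>f'\<close>, valid only on \<open>S\<close>, stand in for
  \<open>deriv f\<close> in the inductions below.\<close>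

lemma diff_times_on_SucI:
  assumes "open S" "\<And>x. x \<in> S \<Longrightarrow> (f has_real_derivative f' x) (at x)" "diff_times_on n S f'"
  shows "diff_times_on (Suc n) S f"
proof -
  have "f differentiable (at x)" if "x \<in> S" for x
    using assms(2)[OF that] by (auto simp: real_differentiable_def)
  moreover have "diff_times_on n S (deriv f)"
    by (rule diff_times_on_cong[OF assms(1) _ assms(3)]) (simp add: DERIV_imp_deriv[OF assms(2)])
  ultimately show ?thesis
    by (simp add: diff_times_on_Suc)
qed

lemma diff_times_on_SucE:
  assumes "diff_times_on (Suc n) S f" "x \<in> S"
  shows "(f has_real_derivative deriv f x) (at x)"
  using assms by (simp add: diff_times_on_Suc DERIV_deriv_iff_real_differentiable)

lemma diff_times_on_const: "open S \<Longrightarrow> diff_times_on n S (\<lambda>x. c)"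
proof (induction n arbitrary: c)
  case (Suc n)
  show ?case
    by (rule diff_times_on_SucI[where f' = "\<lambda>x. 0"]) (use Suc in auto)
qed simp

lemma diff_times_on_add:
  assumes "open S" "diff_times_on n S f" "diff_times_on n S g"
  shows "diff_times_on n S (\<lambda>x. f x + g x)"
  using assms
proof (induction n arbitrary: f g)
  case (Suc n)
  show ?case
    by (rule diff_times_on_SucI[where f' = "\<lambda>x. deriv f x + deriv g x"])
      (use Suc in \<open>auto intro!: DERIV_add diff_times_on_SucE simp: diff_times_on_Suc\<close>)
qed simp

lemma diff_times_on_sum:
  assumes "open S" "\<And>i. i \<in> I \<Longrightarrow> diff_times_on n S (f i)"
  shows "diff_times_on n S (\<lambda>x. \<Sum>i\<in>I. f i x)"
  using assms
  by (induction I rule: infinite_finite_induct) (auto intro: diff_times_on_const diff_times_on_add)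

lemma diff_times_on_mult:
  assumes "open S" "diff_times_on n S f" "diff_times_on n S g"
  shows "diff_times_on n S (\<lambda>x. f x * g x)"
  using assms
proof (induction n arbitrary: f g)
  case (Suc n)
  show ?case
  proof (rule diff_times_on_SucI)
    show "((\<lambda>x. f x * g x) has_real_derivative deriv f x * g x + deriv g x * f x) (at x)"
      if "x \<in> S" for x
      using Suc.prems that by (intro DERIV_mult diff_times_on_SucE)
    \<comment> \<open>The product rule mixes derivatives of order \<open>n\<close> with the original
      factors, which are first weakened from order \<open>Suc n\<close> to \<open>n\<close>.\<close>
    show "diff_times_on n S (\<lambda>x. deriv f x * g x + deriv g x * f x)"
      using Suc.prems diff_times_on_SucD[OF Suc.prems(2)] diff_times_on_SucD[OF Suc.prems(3)]
      by (intro diff_times_on_add Suc.IH) (auto simp: diff_times_on_Suc)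
  qed (fact Suc.prems)
qed simp

lemma diff_times_on_compose:
  assumes "open S" "diff_times_on n S f" "diff_times_on n T g" "f ` S \<subseteq> T"
  shows "diff_times_on n S (\<lambda>x. g (f x))"
  using assms
proof (induction n arbitrary: g)
  case (Suc n)
  show ?case
  proof (rule diff_times_on_SucI)
    show "((\<lambda>x. g (f x)) has_real_derivative deriv g (f x) * deriv f x) (at x)"
      if "x \<in> S" for x
      using Suc.prems that by (intro DERIV_chain2 diff_times_on_SucE) auto
    show "diff_times_on n S (\<lambda>x. deriv g (f x) * deriv f x)"
      using Suc.prems diff_times_on_SucD[OF Suc.prems(2)]
      by (intro diff_times_on_mult Suc.IH[of "deriv g"]) (auto simp: diff_times_on_Suc)
  qed (fact Suc.prems)
qed simp

section \<open>Basic smooth functions and closure properties\<close>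

lemma smooth_on_affine: "open S \<Longrightarrow> smooth_on S (\<lambda>x. c * x + d)"
proof -
  assume "open S"
  then have "diff_times_on n S (\<lambda>x. c * x + d)" for n
    by (cases n)
      (auto intro!: diff_times_on_SucI[where f' = "\<lambda>x. c"] diff_times_on_const derivative_eq_intros)
  then show ?thesis
    by (simp add: smooth_on_iff_diff_times_on)
qed

lemma smooth_on_exp: "open S \<Longrightarrow> smooth_on S exp"
proof -
  assume S: "open S"
  have "diff_times_on n S exp" for n
    by (induction n) (auto intro!: diff_times_on_SucI[OF S DERIV_exp])
  then show ?thesis
    by (simp add: smooth_on_iff_diff_times_on)
qed

lemma smooth_on_mult:
  "open S \<Longrightarrow> smooth_on S f \<Longrightarrow> smooth_on S g \<Longrightarrow> smooth_on S (\<lambda>x. f x * g x)"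
  by (simp add: smooth_on_iff_diff_times_on diff_times_on_mult)

lemma smooth_on_sum:
  "open S \<Longrightarrow> (\<And>i. i \<in> I \<Longrightarrow> smooth_on S (f i)) \<Longrightarrow> smooth_on S (\<lambda>x. \<Sum>i\<in>I. f i x)"
  by (simp add: smooth_on_iff_diff_times_on diff_times_on_sum)

lemma smooth_on_compose:
  "open S \<Longrightarrow> smooth_on S f \<Longrightarrow> smooth_on T g \<Longrightarrow> f ` S \<subseteq> T \<Longrightarrow> smooth_on S (\<lambda>x. g (f x))"
  unfolding smooth_on_iff_diff_times_on by (blast intro: diff_times_on_compose)

lemma smooth_on_cong:
  "open S \<Longrightarrow> (\<And>x. x \<in> S \<Longrightarrow> f x = g x) \<Longrightarrow> smooth_on S f \<Longrightarrow> smooth_on S g"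
  unfolding smooth_on_iff_diff_times_on by (blast intro: diff_times_on_cong)

lemma smooth_on_deriv: "smooth_on S f \<Longrightarrow> smooth_on S (deriv f)"
  unfolding smooth_on_iff_diff_times_on by (blast dest: diff_times_on_Suc[THEN iffD1])

text \<open>Made for locally finite sums, which equal a different finite sum near each
  point.\<close>

lemma smooth_on_localI:
  assumes "\<And>x. x \<in> S \<Longrightarrow> \<exists>U. x \<in> U \<and> smooth_on U f"
  shows "smooth_on S f"
  using assms unfolding smooth_on_def by blast

section \<open>A smooth convex ramp\<close>

text \<open>The polynomial parameter makes this family of flat functions closed under
  differentiation, so that smoothness across 0 follows by one induction over all
  \<open>p\<close>.\<close>

definition flat :: "real poly \<Rightarrow> real \<Rightarrow> real" where
  "flat p u = (if u > 0 then poly p (1 / u) * exp (- 1 / u) else 0)"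

lemma flat_eq_0: "u \<le> 0 \<Longrightarrow> flat p u = 0"
  by (simp add: flat_def)

lemma poly_inverse_times_exp_tendsto_0:
  fixes p :: "real poly"
  shows "((\<lambda>u. poly p (1 / u) * exp (- 1 / u)) \<longlongrightarrow> 0) (at_right 0)"
proof -
  have monom: "((\<lambda>u::real. (1 / u) ^ k * exp (- 1 / u)) \<longlongrightarrow> 0) (at_right 0)" for k
  proof -
    \<comment> \<open>Substituting x = 1/u turns the claim into the exponential beating every power
      at infinity.\<close>
    have "((\<lambda>x::real. x ^ k / exp x) \<longlongrightarrow> 0) at_top"
      by (rule tendsto_power_div_exp_0)
    from filterlim_compose[OF this filterlim_inverse_at_top_right]
    show ?thesis
      by (simp add: exp_minus field_simps)
  qed
  have "((\<lambda>u. \<Sum>i\<le>degree p. coeff p i * ((1 / u) ^ i * exp (- 1 / u))) \<longlongrightarrow>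
      (\<Sum>i\<le>degree p. coeff p i * 0)) (at_right 0)"
    by (intro tendsto_intros monom)
  then show ?thesis
    by (simp add: poly_altdef sum_distrib_right mult.assoc)
qed

text \<open>For u > 0, differentiating in 1/u produces the factor 1/u^2, encoded by
  \<open>[:0, 0, 1:]\<close>; the exponential contributes p and the polynomial contributes
  -p'.\<close>

lemma flat_has_derivative:
  "(flat p has_real_derivative flat ([:0, 0, 1:] * (p - pderiv p)) u) (at u)"
proof -
  consider "u > 0" | "u = 0" | "u < 0" by linarith
  then show ?thesis
  proof cases
    case 1
    have "((\<lambda>v. poly p (1 / v) * exp (- 1 / v)) has_real_derivative
        flat ([:0, 0, 1:] * (p - pderiv p)) u) (at u)"
      using 1 by (auto intro!: derivative_eq_intros simp: flat_def field_simps power2_eq_square)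
    moreover have ev: "\<forall>\<^sub>F v in nhds u. poly p (1 / v) * exp (- 1 / v) = flat p v"
      using eventually_nhds_in_open[of "{0<..}" u] 1
      by (auto elim!: eventually_mono simp: flat_def)
    ultimately show ?thesis
      by (simp add: DERIV_cong_ev[OF refl ev refl, symmetric])
  next
    case 2
    \<comment> \<open>From the right the difference quotient at 0 is the same kind of expression
      with p multiplied by the variable, so the previous limit applies.\<close>
    have "((\<lambda>h. flat p h / h) \<longlongrightarrow> 0) (at_right 0)"
      by (rule Lim_transform_eventually[OF poly_inverse_times_exp_tendsto_0[of "[:0, 1:] * p"]])
        (auto simp: eventually_at_filter flat_def)
    moreover have "((\<lambda>h. flat p h / h) \<longlongrightarrow> 0) (at_left 0)"
      by (rule tendsto_eventually) (auto simp: eventually_at_filter flat_def)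
    ultimately have "((\<lambda>h. flat p h / h) \<longlongrightarrow> 0) (at 0)"
      by (simp add: filterlim_split_at_real)
    then show ?thesis
      using 2 by (simp add: DERIV_def flat_eq_0)
  next
    case 3
    have ev: "\<forall>\<^sub>F v in nhds u. 0 = flat p v"
      using eventually_nhds_in_open[of "{..<0}" u] 3
      by (auto elim!: eventually_mono simp: flat_def)
    have "(flat p has_real_derivative 0) (at u)"
      by (simp add: DERIV_cong_ev[OF refl ev refl, symmetric])
    then show ?thesis
      using 3 by (simp add: flat_eq_0)
  qed
qed

lemma smooth_on_flat: "open S \<Longrightarrow> smooth_on S (flat p)"
proof -
  assume S: "open S"
  have "diff_times_on n S (flat p)" for n
    by (induction n arbitrary: p) (auto intro!: diff_times_on_SucI[OF S flat_has_derivative])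
  then show ?thesis
    by (simp add: smooth_on_iff_diff_times_on)
qed

text \<open>The function P of the overview shifted by 1. The factor u is not a polynomial in 1/u,
  but the derivative of the product is again a \<open>flat\<close>.\<close>

definition ramp :: "real \<Rightarrow> real" where
  "ramp u = u * flat 1 u"

lemma ramp_eq_0: "u \<le> 0 \<Longrightarrow> ramp u = 0"
  by (simp add: ramp_def flat_eq_0)

lemma ramp_nonneg: "0 \<le> ramp u"
  by (simp add: ramp_def flat_def)

lemma ramp_le: "0 \<le> u \<Longrightarrow> ramp u \<le> u"
  by (auto simp: ramp_def flat_def intro!: mult_left_le)

lemma ramp_ge: assumes "1 \<le> u" shows "u / 4 \<le> ramp u"
proof -
  have "exp (-1) \<le> exp (- 1 / u)"
    using assms by (simp add: field_simps)
  \<comment> \<open>This follows from e \<le> 3.\<close>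
  moreover have "(1 / 4 :: real) \<le> exp (-1)"
    using exp_le by (simp add: exp_minus field_simps)
  ultimately have "1 / 4 \<le> exp (- 1 / u)"
    by linarith
  then show ?thesis
    using assms mult_left_mono[of "1/4" "exp (- 1 / u)" u] by (simp add: ramp_def flat_def)
qed

lemma ramp_has_derivative: "(ramp has_real_derivative flat [:1, 1:] u) (at u)"
  unfolding ramp_def[abs_def]
  by (rule derivative_eq_intros flat_has_derivative refl)+
    (auto simp: flat_def field_simps power2_eq_square)

lemma smooth_on_ramp: "open S \<Longrightarrow> smooth_on S ramp"
  unfolding ramp_def[abs_def]
  using smooth_on_affine[of S 1 0] by (intro smooth_on_mult smooth_on_flat) auto

text \<open>The derivative is \<open>flat\<close> of the cube of the variable, hence nonnegative. As
  \<open>flat [:1, 1:]\<close> is the derivative of \<open>ramp\<close>, this is what makes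
  \<open>ramp\<close> convex.\<close>

lemma flat_mono: assumes "u \<le> v" shows "flat [:1, 1:] u \<le> flat [:1, 1:] v"
proof (rule DERIV_nonneg_imp_nondecreasing[OF assms])
  fix x
  have "0 \<le> flat ([:0, 0, 1:] * ([:1, 1:] - pderiv [:1, 1:])) x"
    by (simp add: flat_def pderiv_pCons)
  then show "\<exists>y. (flat [:1, 1:] has_real_derivative y) (at x) \<and> 0 \<le> y"
    using flat_has_derivative by blast
qed

lemma flat_nonneg: "0 \<le> flat [:1, 1:] u"
  by (simp add: flat_def)

lemma ramp_mono: "u \<le> v \<Longrightarrow> ramp u \<le> ramp v"
  by (rule DERIV_nonneg_imp_nondecreasing) (use ramp_has_derivative flat_nonneg in blast)+

lemma ramp_convex: "convex_on UNIV ramp"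
  by (rule convex_on_realI[OF _ ramp_has_derivative]) (auto intro: flat_mono)

text \<open>In terms of t = u + 1 and P t = ramp (t - 1), the left-hand side is t P'(t) - P t, and the
  derivative of P (exp x) * exp (- x) is this divided by t = exp x.\<close>
lemma ramp_legendre: "(u + 1) * flat [:1, 1:] u - ramp u = flat [:2, 1:] u"
  by (auto simp: flat_def ramp_def field_simps)

lemma flat_legendre_bounds: "0 \<le> flat [:2, 1:] u" "flat [:2, 1:] u \<le> 2"
proof -
  show "0 \<le> flat [:2, 1:] u"
    by (simp add: flat_def)
  \<comment> \<open>With v = 1/u, the upper bound reads (2 + v) exp(-v) \<le> 2.\<close>
  have "2 + v \<le> 2 * exp v" if "0 \<le> v" for v :: real
    using exp_ge_add_one_self[of v] that by linarith
  from this[of "1 / u"] show "flat [:2, 1:] u \<le> 2"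
    by (auto simp: flat_def exp_minus field_simps)
qed

section \<open>Sums of ramps at lacunary scales\<close>

text \<open>Doubling makes the largest scale below t dominate all smaller ones; the start at 1 makes
  the sum vanish on [0,1]. The scales remain free to grow as fast as a given family
  requires.\<close>

locale lacunary =
  fixes a :: "nat \<Rightarrow> real"
  assumes one_le_a0: "1 \<le> a 0" and a_double: "2 * a n \<le> a (Suc n)"
begin

section \<open>Growth of the scales\<close>

lemma a_ge: "2 ^ n \<le> a n"
proof (induction n)
  case (Suc n)
  then show ?case using a_double[of n] by simp
qed (simp add: one_le_a0)

lemma a_ge_1: "1 \<le> a n"
  using a_ge[of n] one_le_power[of "2::real" n] by linarith

lemma a_pos: "0 < a n"
  using a_ge_1[of n] by linarith

lemma a_mono: "mono a"
  unfolding mono_iff_le_Suc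
proof
  fix n show "a n \<le> a (Suc n)"
    using a_double[of n] a_pos[of n] by linarith
qed

lemma ex_a_greater: "\<exists>N. t < a N"
  using real_arch_pow[of 2 t] a_ge by (auto intro: less_le_trans)

lemma sum_a_le: "(\<Sum>n<N. a n) \<le> a N"
proof (induction N)
  case 0
  then show ?case using a_pos[of 0] by simp
next
  case (Suc N)
  then show ?case using a_double[of N] by simp
qed

lemma sum_a_below_le:
  assumes "0 \<le> t"
  shows "(\<Sum>n<N. if a n < t then a n else 0) \<le> 2 * t"
proof (induction N)
  case (Suc N)
  show ?case
  proof (cases "a N < t")
    case True
    \<comment> \<open>When \<open>a N < t\<close>, the earlier scales add up to at most
      \<open>a N\<close>, so the new total is at most \<open>2 * a N\<close>.\<close>
    have "(\<Sum>n<N. if a n < t then a n else 0) \<le> (\<Sum>n<N. a n)"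
      by (rule sum_mono) (use a_pos in \<open>auto simp: less_imp_le\<close>)
    then show ?thesis using True sum_a_le[of N] by simp
  qed (use Suc in simp)
qed (use assms in simp)

text \<open>Scaling both argument and value by \<open>a n\<close> keeps the asymptotic slope the
  same for all n. The factor 1/4 is what brings the derivative of H down to at most 1: it offsets
  the 2 in \<open>flat_legendre_bounds\<close> and the 2 in \<open>sum_a_below_le\<close>.\<close>

definition summand :: "nat \<Rightarrow> real \<Rightarrow> real" where
  "summand n t = a n * ramp (t / a n - 1) / 4"

definition ramp_sum :: "real \<Rightarrow> real" where
  "ramp_sum t = (\<Sum>n. summand n t)"

lemma summand_nonneg: "0 \<le> summand n t"
  using a_pos[of n] ramp_nonneg by (simp add: summand_def)

lemma summand_eq_0: "t \<le> a n \<Longrightarrow> summand n t = 0"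
  using a_pos[of n] by (simp add: summand_def ramp_eq_0)

lemma summand_le: assumes "0 \<le> t" shows "summand n t \<le> t"
proof (cases "t \<le> a n")
  case False
  then have "ramp (t / a n - 1) \<le> t / a n"
    using ramp_le[of "t / a n - 1"] a_pos[of n] by simp
  then have "a n * ramp (t / a n - 1) \<le> t"
    using a_pos[of n] by (simp add: field_simps)
  then show ?thesis
    using assms by (simp add: summand_def)
qed (use assms summand_eq_0 in simp)

lemma summand_ge: assumes "2 * a n \<le> t" shows "t / 32 \<le> summand n t"
proof -
  \<comment> \<open>For s = t / a n \<ge> 2, s - 1 \<ge> s/2; one 1/4 comes from
    \<open>ramp_ge\<close>, the other from \<open>summand\<close>, hence 1/32.\<close>
  have "t / a n / 8 \<le> (t / a n - 1) / 4" "1 \<le> t / a n - 1"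
    using assms a_pos[of n] by (auto simp: field_simps)
  with ramp_ge[of "t / a n - 1"] have "t / a n / 8 \<le> ramp (t / a n - 1)"
    by linarith
  then show ?thesis
    using a_pos[of n] by (simp add: summand_def field_simps)
qed

lemma summand_mono: "s \<le> t \<Longrightarrow> summand n s \<le> summand n t"
  using a_pos[of n] unfolding summand_def
  by (intro divide_right_mono mult_left_mono ramp_mono) (auto simp: divide_right_mono)

lemma summand_convex: "convex_on UNIV (summand n)"
proof (rule convex_onI)
  fix x y u :: real assume l: "0 < u" "u < 1"
  let ?x = "x / a n - 1" and ?y = "y / a n - 1"
  have "((1 - u) *\<^sub>R x + u *\<^sub>R y) / a n - 1 = (1 - u) *\<^sub>R ?x + u *\<^sub>R ?y"
    by (simp add: field_simps add_divide_distrib diff_divide_distrib)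
  then have "ramp (((1 - u) *\<^sub>R x + u *\<^sub>R y) / a n - 1) \<le> (1 - u) * ramp ?x + u * ramp ?y"
    using convex_onD[OF ramp_convex, of u ?x ?y] l by simp
  then have "a n * ramp (((1 - u) *\<^sub>R x + u *\<^sub>R y) / a n - 1)
      \<le> a n * ((1 - u) * ramp ?x + u * ramp ?y)"
    using a_pos[of n] by (intro mult_left_mono) auto
  then show "summand n ((1 - u) *\<^sub>R x + u *\<^sub>R y) \<le> (1 - u) * summand n x + u * summand n y"
    by (simp add: summand_def field_simps)
qed simp

lemma summand_has_derivative:
  "(summand n has_real_derivative flat [:1, 1:] (t / a n - 1) / 4) (at t)"
  unfolding summand_def[abs_def] using a_pos[of n]
  by (auto intro!: derivative_eq_intros DERIV_chain2[OF ramp_has_derivative] simp: field_simps)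

lemma smooth_on_summand: "open S \<Longrightarrow> smooth_on S (summand n)"
proof -
  assume S: "open S"
  have "smooth_on S (\<lambda>t. ramp ((1 / a n) * t + (- 1)))"
    by (rule smooth_on_compose[OF S smooth_on_affine[OF S] smooth_on_ramp[OF open_UNIV]]) simp
  from smooth_on_mult[OF S _ this, of "\<lambda>_. a n / 4"] smooth_on_affine[OF S, of 0 "a n / 4"]
  show ?thesis
    by (simp add: summand_def[abs_def])
qed

text \<open>Local finiteness: summands from index \<open>N\<close> on have not yet started at t.
  Smoothness and derivatives of the series thus reduce to finite sums.\<close>

lemma ramp_sum_eq_sum: assumes "t \<le> a N" shows "ramp_sum t = (\<Sum>n<N. summand n t)"
  unfolding ramp_sum_def
proof (rule suminf_finite)
  fix n assume "n \<notin> {..<N}"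
  then have "a N \<le> a n"
    using a_mono by (simp add: monoD)
  then show "summand n t = 0"
    using assms by (intro summand_eq_0) simp
qed simp

lemma summable_summand: "summable (\<lambda>n. summand n t)"
proof -
  obtain N where "t < a N" using ex_a_greater by blast
  then have "summand n t = 0" if "n \<ge> N" for n
    using that a_mono by (intro summand_eq_0) (meson less_imp_le monoD order_trans)
  then show ?thesis
    by (intro summable_finite[of "{..<N}"]) (auto simp: not_less)
qed

lemma ramp_sum_eq_0: "t \<le> 1 \<Longrightarrow> ramp_sum t = 0"
  using ramp_sum_eq_sum[of t 0] one_le_a0 by simp

lemma ramp_sum_mono: "s \<le> t \<Longrightarrow> ramp_sum s \<le> ramp_sum t"
  unfolding ramp_sum_def by (intro suminf_le summand_mono summable_summand)

lemma ramp_sum_convex: "convex_on UNIV ramp_sum"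
proof (rule convex_onI)
  fix x y u :: real assume l: "0 < u" "u < 1"
  have "ramp_sum ((1 - u) *\<^sub>R x + u *\<^sub>R y) \<le> (\<Sum>n. (1 - u) * summand n x + u * summand n y)"
    unfolding ramp_sum_def using l
    by (intro suminf_le summable_summand summable_add summable_mult convex_onD[OF summand_convex]) auto
  also have "\<dots> = (1 - u) * ramp_sum x + u * ramp_sum y"
    unfolding ramp_sum_def
    by (simp add: suminf_add[symmetric] suminf_mult summable_summand summable_mult)
  finally show "ramp_sum ((1 - u) *\<^sub>R x + u *\<^sub>R y) \<le> (1 - u) * ramp_sum x + u * ramp_sum y" .
qed simp

lemma smooth_on_ramp_sum: "smooth_on S ramp_sum"
proof (rule smooth_on_localI)
  fix t
  obtain N where N: "t < a N" using ex_a_greater by blast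
  have "smooth_on {..<a N} ramp_sum"
    by (rule smooth_on_cong[OF _ _ smooth_on_sum[of _ "{..<N}", OF _ smooth_on_summand]])
      (auto simp: ramp_sum_eq_sum[of _ N])
  with N show "\<exists>U. t \<in> U \<and> smooth_on U ramp_sum" by auto
qed

section \<open>The sum in the logarithmic variable\<close>

lemma ramp_sum_has_derivative:
  assumes "t < a N"
  shows "(ramp_sum has_real_derivative (\<Sum>n<N. flat [:1, 1:] (t / a n - 1) / 4)) (at t)"
proof -
  have ev: "\<forall>\<^sub>F s in nhds t. (\<Sum>n<N. summand n s) = ramp_sum s"
    using eventually_nhds_in_open[of "{..<a N}" t] assms
    by (auto elim!: eventually_mono simp: ramp_sum_eq_sum[of _ N])
  have "((\<lambda>s. \<Sum>n<N. summand n s) has_real_derivative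
      (\<Sum>n<N. flat [:1, 1:] (t / a n - 1) / 4)) (at t)"
    by (intro DERIV_sum summand_has_derivative)
  then show ?thesis
    by (simp add: DERIV_cong_ev[OF refl ev refl, symmetric])
qed

lemma log_ramp_sum_has_derivative:
  obtains D where "((\<lambda>x. ramp_sum (exp x) * exp (- x)) has_real_derivative D) (at x)"
    and "0 \<le> D" and "D \<le> 1"
proof -
  define t where "t = exp x"
  have t: "t > 0" by (simp add: t_def)
  obtain N where N: "t < a N" using ex_a_greater by blast
  \<comment> \<open>The contribution of the n-th summand to G'(t) - G(t)/t, rewritten by
    \<open>ramp_legendre\<close> with u = t / a n - 1.\<close>
  define d where "d n = a n * flat [:2, 1:] (t / a n - 1) / (4 * t)" for n
  have d: "flat [:1, 1:] (t / a n - 1) / 4 - summand n t / t = d n" for n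
    using a_pos[of n] t
    by (simp add: d_def summand_def ramp_legendre[symmetric] field_simps)
  have "((\<lambda>x. ramp_sum (exp x) * exp (- x)) has_real_derivative
      (\<Sum>n<N. flat [:1, 1:] (t / a n - 1) / 4) * t * exp (- x) - ramp_sum t * exp (- x)) (at x)"
    using ramp_sum_has_derivative[OF N] unfolding t_def
    by (auto intro!: derivative_eq_intros DERIV_chain2[where f = ramp_sum])
  also have "(\<Sum>n<N. flat [:1, 1:] (t / a n - 1) / 4) * t * exp (- x) - ramp_sum t * exp (- x)
      = (\<Sum>n<N. flat [:1, 1:] (t / a n - 1) / 4) - (\<Sum>n<N. summand n t) / t"
  proof -
    have "exp (- x) = 1 / t"
      by (simp add: t_def exp_minus field_simps)
    then show ?thesis
      using N t by (simp add: ramp_sum_eq_sum[of t N])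
  qed
  also have "\<dots> = (\<Sum>n<N. d n)"
    by (simp add: d[symmetric] sum_subtractf sum_divide_distrib)
  finally have deriv: "((\<lambda>x. ramp_sum (exp x) * exp (- x)) has_real_derivative (\<Sum>n<N. d n)) (at x)" .
  \<comment> \<open>Only scales below t contribute, so the bound sums to a total controlled by
    \<open>sum_a_below_le\<close>.\<close>
  have "d n \<le> (if a n < t then a n else 0) / (2 * t)" for n
  proof (cases "a n < t")
    case True
    have "a n * flat [:2, 1:] (t / a n - 1) \<le> a n * 2"
      using a_pos[of n] flat_legendre_bounds(2) by (intro mult_left_mono) auto
    from divide_right_mono[OF this, of "4 * t"] show ?thesis
      using True t by (simp add: d_def)
  next
    case False
    then have "t / a n - 1 \<le> 0" using a_pos[of n] by simp
    then show ?thesis using False by (simp add: d_def flat_eq_0)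
  qed
  then have "(\<Sum>n<N. d n) \<le> (\<Sum>n<N. if a n < t then a n else 0) / (2 * t)"
    by (simp add: sum_divide_distrib sum_mono)
  also have "\<dots> \<le> 1"
    using sum_a_below_le[of t N] t by simp
  finally have "(\<Sum>n<N. d n) \<le> 1" .
  moreover have "0 \<le> (\<Sum>n<N. d n)"
    unfolding d_def using a_pos flat_legendre_bounds(1) t
    by (intro sum_nonneg divide_nonneg_nonneg mult_nonneg_nonneg) (auto simp: less_imp_le)
  ultimately show thesis
    using that deriv by blast
qed

lemma smooth_on_log_ramp_sum: "smooth_on UNIV (\<lambda>x. ramp_sum (exp x) * exp (- x))"
proof -
  have "smooth_on UNIV (\<lambda>x::real. exp ((- 1) * x + 0))"
    by (rule smooth_on_compose[OF open_UNIV smooth_on_affine[OF open_UNIV] smooth_on_exp[OF open_UNIV]])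
      simp
  moreover have "smooth_on UNIV (\<lambda>x. ramp_sum (exp x))"
    by (rule smooth_on_compose[OF open_UNIV smooth_on_exp[OF open_UNIV] smooth_on_ramp_sum[of UNIV]]) simp
  ultimately show ?thesis
    using smooth_on_mult[OF open_UNIV] by simp
qed

lemma log_ramp_sum_at_top: "filterlim (\<lambda>x. ramp_sum (exp x) * exp (- x)) at_top at_top"
  unfolding filterlim_at_top
proof
  fix Z :: real
  \<comment> \<open>Past \<open>2 * a N\<close>, each of the first \<open>N\<close> summands exceeds
    1/32 of exp x or equals it, so \<open>N\<close> of them push H above \<open>Z\<close>.\<close>
  obtain N :: nat where N: "Z * 32 \<le> real N" using real_arch_simple by blast
  show "\<forall>\<^sub>F x in at_top. Z \<le> ramp_sum (exp x) * exp (- x)"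
    using eventually_ge_at_top[of "ln (2 * a N)"]
  proof eventually_elim
    case (elim x)
    then have "exp (ln (2 * a N)) \<le> exp x"
      by simp
    then have le: "2 * a N \<le> exp x"
      using a_pos[of N] by simp
    have "real N * (exp x / 32) = (\<Sum>n<N. exp x / 32)"
      by simp
    also have "\<dots> \<le> (\<Sum>n<N. summand n (exp x))"
    proof (intro sum_mono summand_ge)
      fix n assume "n \<in> {..<N}"
      then show "2 * a n \<le> exp x"
        using monoD[OF a_mono, of n N] le by simp
    qed
    also have "\<dots> \<le> ramp_sum (exp x)"
      unfolding ramp_sum_def
      by (intro sum_le_suminf summable_summand) (auto simp: summand_nonneg)
    finally have "real N / 32 \<le> ramp_sum (exp x) * exp (- x)"
      by (simp add: exp_minus field_simps)
    with N show ?case by linarith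
  qed
qed

text \<open>Integrate termwise, all terms being nonnegative; the n-th term is at most |f| and
  vanishes where |f| \<le> \<open>a n\<close>, so it is dominated by a tail of |f|.\<close>

lemma nn_integral_ramp_sum_le:
  assumes f: "f \<in> borel_measurable M"
  shows "(\<integral>\<^sup>+x. ennreal (ramp_sum \<bar>f x\<bar>) \<partial>M) \<le>
    (\<Sum>n. \<integral>\<^sup>+x\<in>{y \<in> space M. \<bar>f y\<bar> > a n}. ennreal \<bar>f x\<bar> \<partial>M)"
proof -
  have [measurable]: "summand n \<in> borel_measurable borel" for n
    by (intro borel_measurable_continuous_onI continuous_at_imp_continuous_on ballI
        DERIV_isCont[OF summand_has_derivative])
  note f [measurable]
  have "(\<integral>\<^sup>+x. ennreal (ramp_sum \<bar>f x\<bar>) \<partial>M) = (\<integral>\<^sup>+x. (\<Sum>n. ennreal (summand n \<bar>f x\<bar>)) \<partial>M)"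
    unfolding ramp_sum_def by (simp add: suminf_ennreal2 summand_nonneg summable_summand)
  also have "\<dots> = (\<Sum>n. \<integral>\<^sup>+x. ennreal (summand n \<bar>f x\<bar>) \<partial>M)"
    by (rule nn_integral_suminf) measurable
  also have "\<dots> \<le> (\<Sum>n. \<integral>\<^sup>+x\<in>{y \<in> space M. \<bar>f y\<bar> > a n}. ennreal \<bar>f x\<bar> \<partial>M)"
  proof (intro suminf_le summableI nn_integral_mono)
    fix n x assume "x \<in> space M"
    then show "ennreal (summand n \<bar>f x\<bar>) \<le>
        ennreal \<bar>f x\<bar> * indicator {y \<in> space M. \<bar>f y\<bar> > a n} x"
      using summand_le[of "\<bar>f x\<bar>" n] summand_eq_0[of "\<bar>f x\<bar>" n]
      by (cases "\<bar>f x\<bar> \<le> a n") (auto simp: ennreal_leI)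
  qed
  finally show ?thesis .
qed

end

section \<open>Uniform integrability\<close>

lemma uniformly_integrable_imp_ramp_sum_bound:
  assumes "uniformly_integrable M F" and F: "F \<subseteq> borel_measurable M"
  obtains a where "lacunary a"
    and "(SUP f\<in>F. \<integral>\<^sup>+x. ennreal (lacunary.ramp_sum a \<bar>f x\<bar>) \<partial>M) \<le> 1"
proof -
  define tail where
    "tail C = (SUP f\<in>F. \<integral>\<^sup>+x\<in>{y \<in> space M. \<bar>f y\<bar> > C}. ennreal \<bar>f x\<bar> \<partial>M)" for C :: real
  have tail: "(tail \<longlongrightarrow> 0) at_top"
    using assms(1) by (simp add: uniformly_integrable_def tail_def[abs_def])
  \<comment> \<open>Small tails occur beyond any bound \<open>b\<close>, so smallness and doubling
    can be met together; the choice is dependent because each scale must be at least twice the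
    previous one. The exponent \<open>Suc n\<close> makes the tail bounds sum to exactly 1.\<close>
  have scale: "\<exists>x\<ge>b. 1 \<le> x \<and> tail x \<le> ennreal ((1 / 2) ^ Suc n)" for n and b :: real
  proof -
    have "\<forall>\<^sub>F x in at_top. tail x < ennreal ((1 / 2) ^ Suc n)"
      by (rule order_tendstoD(2)[OF tail]) (simp add: ennreal_less_zero_iff)
    from eventually_conj[OF this eventually_ge_at_top[of "max b 1"]]
    have "\<exists>x. tail x < ennreal ((1 / 2) ^ Suc n) \<and> max b 1 \<le> x"
      by (intro eventually_happens'[OF trivial_limit_at_top_linorder])
    then show ?thesis by (auto intro: less_imp_le)
  qed
  have "\<exists>a. \<forall>n. (1 \<le> a n \<and> tail (a n) \<le> ennreal ((1 / 2) ^ Suc n)) \<and> 2 * a n \<le> a (Suc n)"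
  proof (rule dependent_nat_choice)
    show "\<exists>x. 1 \<le> x \<and> tail x \<le> ennreal ((1 / 2) ^ Suc 0)"
      using scale[of 0 0] by auto
    show "\<exists>y. (1 \<le> y \<and> tail y \<le> ennreal ((1 / 2) ^ Suc (Suc n))) \<and> 2 * x \<le> y" for x n
      using scale[of "2 * x" "Suc n"] by auto
  qed
  then obtain a where a: "\<And>n. 1 \<le> a n" "\<And>n. tail (a n) \<le> ennreal ((1 / 2) ^ Suc n)"
    "\<And>n. 2 * a n \<le> a (Suc n)"
    by blast
  interpret lacunary a
    by unfold_locales (use a in auto)
  have "(\<integral>\<^sup>+x. ennreal (ramp_sum \<bar>f x\<bar>) \<partial>M) \<le> 1" if "f \<in> F" for f
  proof -
    have "(\<integral>\<^sup>+x. ennreal (ramp_sum \<bar>f x\<bar>) \<partial>M) \<le>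
        (\<Sum>n. \<integral>\<^sup>+x\<in>{y \<in> space M. \<bar>f y\<bar> > a n}. ennreal \<bar>f x\<bar> \<partial>M)"
      using F that by (intro nn_integral_ramp_sum_le) auto
    also have "\<dots> \<le> (\<Sum>n. ennreal ((1 / 2) ^ Suc n))"
    proof (intro suminf_le summableI)
      fix n
      show "(\<integral>\<^sup>+x\<in>{y \<in> space M. \<bar>f y\<bar> > a n}. ennreal \<bar>f x\<bar> \<partial>M) \<le> ennreal ((1 / 2) ^ Suc n)"
        by (rule order_trans[OF _ a(2)[of n]], unfold tail_def, rule SUP_upper[OF that])
    qed
    also have "\<dots> = 1"
      by (subst suminf_ennreal_eq[OF _ power_half_series]) simp_all
    finally show ?thesis .
  qed
  then have "(SUP f\<in>F. \<integral>\<^sup>+x. ennreal (ramp_sum \<bar>f x\<bar>) \<partial>M) \<le> 1"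
    by (rule SUP_least)
  with that lacunary_axioms show thesis by blast
qed

text \<open>Once G(t) \<ge> t/r for all large t, the tail of |f| beyond such a level is at most r
  times the integral of G(|f|), hence at most r, uniformly over \<open>F\<close>.\<close>

lemma superlinear_imp_uniformly_integrable:
  fixes G :: "real \<Rightarrow> real"
  assumes F: "F \<subseteq> borel_measurable M"
    and bound: "(SUP f\<in>F. \<integral>\<^sup>+x. ennreal (G \<bar>f x\<bar>) \<partial>M) \<le> 1"
    and lim: "filterlim (\<lambda>x. G (exp x) * exp (- x)) at_top at_top"
  shows "uniformly_integrable M F"
  unfolding uniformly_integrable_def
proof (rule order_tendstoI)
  fix e :: ennreal assume "0 < e"
  \<comment> \<open>\<open>e\<close> may be infinite, so a finite real \<open>r\<close> strictly
    below it is extracted first.\<close>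
  then obtain m where m: "0 < m" "m < e"
    using dense by blast
  then obtain r where r: "0 < r" "ennreal r < e"
    by (cases m) auto
  from lim obtain X where X: "\<And>x. X \<le> x \<Longrightarrow> 1 / r \<le> G (exp x) * exp (- x)"
    unfolding filterlim_at_top eventually_at_top_linorder by blast
  have G: "t \<le> r * G t" if "exp X \<le> t" for t
  proof -
    have "0 < t" using that exp_gt_zero[of X] by linarith
    with X[of "ln t"] that have "1 / r \<le> G t / t"
      by (simp add: exp_minus ln_ge_iff divide_inverse)
    then show ?thesis
      using \<open>0 < t\<close> r(1) by (simp add: field_simps)
  qed
  show "\<forall>\<^sub>F C in at_top.
      (SUP f\<in>F. \<integral>\<^sup>+x\<in>{y \<in> space M. \<bar>f y\<bar> > C}. ennreal \<bar>f x\<bar> \<partial>M) < e"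
    using eventually_ge_at_top[of "exp X"]
  proof eventually_elim
    case (elim C)
    have "(\<integral>\<^sup>+x\<in>{y \<in> space M. \<bar>f y\<bar> > C}. ennreal \<bar>f x\<bar> \<partial>M) \<le> ennreal r" if "f \<in> F" for f
    proof -
      have [measurable]: "f \<in> borel_measurable M" using F that by blast
      let ?g = "\<lambda>x. ennreal \<bar>f x\<bar> * indicator {y \<in> space M. \<bar>f y\<bar> > C} x"
      \<comment> \<open>The constant is moved into this integral because \<open>?g\<close> is known
        to be measurable, while nothing is assumed about measurability of \<open>G\<close>.\<close>
      have "ennreal (1 / r) * (\<integral>\<^sup>+x. ?g x \<partial>M) = (\<integral>\<^sup>+x. ennreal (1 / r) * ?g x \<partial>M)"
        by (rule nn_integral_cmult[symmetric]) measurable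
      also have "\<dots> \<le> (\<integral>\<^sup>+x. ennreal (G \<bar>f x\<bar>) \<partial>M)"
      proof (rule nn_integral_mono)
        fix x
        show "ennreal (1 / r) * ?g x \<le> ennreal (G \<bar>f x\<bar>)"
        proof (cases "x \<in> space M \<and> C < \<bar>f x\<bar>")
          case True
          then have "\<bar>f x\<bar> / r \<le> G \<bar>f x\<bar>"
            using G[of "\<bar>f x\<bar>"] elim r(1) by (simp add: pos_divide_le_eq mult.commute)
          then show ?thesis
            using True r(1) by (simp add: ennreal_mult[symmetric] ennreal_leI)
        qed auto
      qed
      also have "\<dots> \<le> 1"
        using order_trans[OF SUP_upper[OF that] bound] .
      finally have "ennreal r * (ennreal (1 / r) * (\<integral>\<^sup>+x. ?g x \<partial>M)) \<le> ennreal r * 1"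
        by (rule mult_left_mono) simp
      moreover have "ennreal r * ennreal (1 / r) = 1"
        using r(1) by (simp flip: ennreal_mult)
      ultimately show ?thesis
        by (simp flip: mult.assoc)
    qed
    then show ?case
      using r(2) by (intro le_less_trans[OF SUP_least])
  qed
qed simp

theorem theorem5p12:
  fixes M :: "'a measure" and F :: "('a \<Rightarrow> real) set"
  assumes "sigma_finite_measure M"
    and "F \<subseteq> {f. integrable M f}"
  shows "uniformly_integrable M F \<longleftrightarrow>
    (\<exists>G::real \<Rightarrow> real.
      (\<forall>x\<in>{0..1}. G x = 0) \<and>
      mono_on {0..} G \<and> convex_on {0..} G \<and> smooth_on {0<..} G \<and>
      (SUP f\<in>F. \<integral>\<^sup>+x. ennreal (G \<bar>f x\<bar>) \<partial>M) \<le> 1 \<and>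
      (let H = (\<lambda>x::real. G (exp x) * exp (- x)) in
        filterlim H at_top at_top \<and>
        (\<forall>x. H differentiable (at x)) \<and>
        smooth_on UNIV (deriv H) \<and>
        (\<forall>x. 0 \<le> deriv H x \<and> deriv H x \<le> 1)))"
    (is "_ \<longleftrightarrow> (\<exists>G. ?admissible G)")
proof
  have F: "F \<subseteq> borel_measurable M"
    using assms(2) by auto
  show "uniformly_integrable M F" if "\<exists>G. ?admissible G"
    using that superlinear_imp_uniformly_integrable[OF F] unfolding Let_def by blast
  assume "uniformly_integrable M F"
  then obtain a where a: "lacunary a"
    and bound: "(SUP f\<in>F. \<integral>\<^sup>+x. ennreal (lacunary.ramp_sum a \<bar>f x\<bar>) \<partial>M) \<le> 1"
    using uniformly_integrable_imp_ramp_sum_bound F by blast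
  interpret lacunary a by (fact a)
  let ?H = "\<lambda>x. ramp_sum (exp x) * exp (- x)"
  have H: "?H differentiable (at x) \<and> 0 \<le> deriv ?H x \<and> deriv ?H x \<le> 1" for x
  proof -
    obtain D where D: "(?H has_real_derivative D) (at x)" "0 \<le> D" "D \<le> 1"
      using log_ramp_sum_has_derivative by blast
    then show ?thesis
      using DERIV_imp_deriv[OF D(1)] by (auto simp: real_differentiable_def)
  qed
  \<comment> \<open>The sum is defined, monotone, convex and smooth on the whole line, and is
    restricted here to the half-line.\<close>
  have "?admissible ramp_sum"
    using H bound ramp_sum_eq_0 ramp_sum_mono smooth_on_ramp_sum log_ramp_sum_at_top
      smooth_on_deriv[OF smooth_on_log_ramp_sum] convex_on_subset[OF ramp_sum_convex]
    by (auto simp: Let_def intro: mono_onI)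
  then show "\<exists>G. ?admissible G" by blast
qed

end
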